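(* For every $x\in\mathbf{Q}_{>0}$ one has $\mathrm{cds}(1+x)=-\mathrm{cds}(x)$. Hence $\mathrm{cds}$ is 2-periodic on $\mathbf{Q}_{>0}$, i.e. $\mathrm{cds}(x+2)=\mathrm{cds}(x)$ for all $x\in\mathbf{Q}_{>0}$.
   Context: The codenominator $\mathsf{F}:\mathbf{Q}_{>0}\to\mathbf{Z}_{>0}$ is the unique function with $\mathsf{F}(1)=1$ satisfying, for all $x\in\mathbf{Q}_{>0}$, $\mathsf{F}(1+1/x)=\mathsf{F}(x)$ and $\mathsf{F}\left(\frac{1}{1+x}\right)=\mathsf{F}(x)+\mathsf{F}(1/x)$. The codiscriminant $\mathrm{cds}:\mathbf{Q}_{>0}\to\mathbf{Z}$ is defined by $\mathrm{cds}(x):=\mathsf{F}(1/x)^2-\mathsf{F}(x)\mathsf{F}(1/x)-\mathsf{F}(x)^2$. *)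

theory Defs
  imports Complex_Main
begin

text \<open>The defining properties of the codenominator. Nothing is said about its values at
  non-positive rationals, so this predicate determines a function only up to these values.\<close>

definition is_codenominator :: "(rat \<Rightarrow> int) \<Rightarrow> bool" where
  "is_codenominator F \<longleftrightarrow>
     (\<forall>x>0. F x > 0) \<and>
     F 1 = 1 \<and>
     (\<forall>x>0. F (1 + 1 / x) = F x) \<and>
     (\<forall>x>0. F (1 / (1 + x)) = F x + F (1 / x))"

text \<open>The value \<open>0\<close> at non-positive rationals is a junk value that makes the description unique;
  existence and uniqueness are proved in \<open>codenominator_ex1\<close> below.\<close>

definition codenominator :: "rat \<Rightarrow> int" where
  "codenominator = (THE F. is_codenominator F \<and> (\<forall>x\<le>0. F x = 0))"

definition cds :: "rat \<Rightarrow> int" where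
  "cds x = (codenominator (1 / x))\<^sup>2 - codenominator x * codenominator (1 / x) - (codenominator x)\<^sup>2"

lemma pos_rat_cases_nat:
  assumes "(0::rat) < x"
  shows "\<exists>p q. 0 < p \<and> 0 < q \<and> x = of_nat p / of_nat q"
proof -
  obtain a b where ab: "quotient_of x = (a, b)" by fastforce
  have b: "b > 0" using quotient_of_denom_pos[OF ab] .
  have x: "x = of_int a / of_int b" using quotient_of_div[OF ab] .
  have a: "a > 0" using assms b unfolding x by (simp add: zero_less_divide_iff)
  have "x = of_nat (nat a) / of_nat (nat b)" using a b x by simp
  then show ?thesis using a b by (metis zero_less_nat_eq)
qed

definition rat_height :: "rat \<Rightarrow> nat" where
  "rat_height x = (LEAST n. \<exists>p q. 0 < p \<and> 0 < q \<and> x = of_nat p / of_nat q \<and> n = p + q)"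

lemma rat_height_obtain:
  assumes "0 < x"
  obtains p q where "0 < p" "0 < q" "x = of_nat p / of_nat q" "rat_height x = p + q"
proof -
  have "\<exists>n p q. 0 < p \<and> 0 < q \<and> x = of_nat p / of_nat q \<and> n = p + q"
    using pos_rat_cases_nat[OF assms] by blast
  from LeastI_ex[OF this] show ?thesis using that unfolding rat_height_def by blast
qed

lemma rat_height_le:
  assumes "0 < p" "0 < q" "x = of_nat p / of_nat q"
  shows "rat_height x \<le> p + q"
  unfolding rat_height_def by (rule Least_le) (use assms in blast)

lemma rat_height_gt_1:
  assumes "1 < x"
  shows "rat_height (1 / (x - 1)) < rat_height x"
proof -
  obtain p q where pq: "0 < p" "0 < q" "x = of_nat p / of_nat q" "rat_height x = p + q"
    using rat_height_obtain[of x] assms by auto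
  have lt: "q < p" using assms pq by (simp add: less_divide_eq)
  have "1 / (x - 1) = of_nat q / of_nat (p - q)"
    unfolding pq(3) using pq(1,2) lt by (simp add: of_nat_diff field_simps)
  from rat_height_le[OF _ _ this] show ?thesis using lt pq by simp
qed

lemma rat_height_lt_1:
  assumes "0 < x" "x < 1"
  shows "rat_height (1 / x - 1) < rat_height x" "rat_height (x / (1 - x)) < rat_height x"
proof -
  obtain p q where pq: "0 < p" "0 < q" "x = of_nat p / of_nat q" "rat_height x = p + q"
    using rat_height_obtain[of x] assms by auto
  have lt: "p < q" using assms pq by (simp add: divide_less_eq)
  have 1: "1 / x - 1 = of_nat (q - p) / of_nat p"
    unfolding pq(3) using pq(1,2) lt by (simp add: of_nat_diff field_simps)
  have 2: "x / (1 - x) = of_nat p / of_nat (q - p)"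
    unfolding pq(3) using pq(1,2) lt by (simp add: of_nat_diff field_simps)
  show "rat_height (1 / x - 1) < rat_height x" using rat_height_le[OF _ _ 1] lt pq by simp
  show "rat_height (x / (1 - x)) < rat_height x" using rat_height_le[OF _ _ 2] lt pq by simp
qed

function codenominator_rec :: "rat \<Rightarrow> int" where
  "codenominator_rec x =
     (if x \<le> 0 then 0
      else if x = 1 then 1
      else if x > 1 then codenominator_rec (1 / (x - 1))
      else codenominator_rec (1 / x - 1) + codenominator_rec (x / (1 - x)))"
  by auto
termination
  by (relation "measure rat_height") (auto intro: rat_height_gt_1 rat_height_lt_1)

declare codenominator_rec.simps [simp del]

lemma codenominator_rec_pos: "0 < x \<Longrightarrow> 0 < codenominator_rec x"
proof (induction x rule: codenominator_rec.induct)
  case (1 x)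
  then show ?case by (subst codenominator_rec.simps) (auto intro!: add_pos_pos)
qed

lemma is_codenominator_rec: "is_codenominator codenominator_rec"
  unfolding is_codenominator_def
proof (intro conjI allI impI)
  fix x :: rat assume x: "x > 0"
  show "codenominator_rec x > 0" using x by (rule codenominator_rec_pos)
  have "1 < 1 + 1 / x" using x by simp
  moreover from this have "\<not> 1 + 1 / x \<le> 0" by linarith
  ultimately show "codenominator_rec (1 + 1 / x) = codenominator_rec x"
    by (subst codenominator_rec.simps) auto
  define y where "y = 1 / (1 + x)"
  have y: "0 < y" "y < 1" "1 / y - 1 = x" "y / (1 - y) = 1 / x"
    using x by (auto simp: y_def field_simps)
  have "codenominator_rec y = codenominator_rec x + codenominator_rec (1 / x)"
    using y by (subst codenominator_rec.simps) auto
  then show "codenominator_rec (1 / (1 + x)) = codenominator_rec x + codenominator_rec (1 / x)"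
    by (simp add: y_def)
next
  show "codenominator_rec 1 = 1" by (simp add: codenominator_rec.simps)
qed

lemma is_codenominator_unique:
  assumes "is_codenominator F" "0 < x"
  shows "F x = codenominator_rec x"
  using assms(2)
proof (induction x rule: codenominator_rec.induct)
  case (1 x)
  have F: "F 1 = 1" "\<And>y. y > 0 \<Longrightarrow> F (1 + 1 / y) = F y"
    "\<And>y. y > 0 \<Longrightarrow> F (1 / (1 + y)) = F y + F (1 / y)"
    using assms(1) unfolding is_codenominator_def by auto
  consider "x = 1" | "x > 1" | "x < 1" by fastforce
  then show ?case
  proof cases
    case 1
    then show ?thesis using F by (simp add: codenominator_rec.simps)
  next
    case 2
    then have "F x = F (1 / (x - 1))" using F(2)[of "1 / (x - 1)"] by simp
    then show ?thesis using 1 2 by (subst codenominator_rec.simps) auto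
  next
    case 3
    have "1 / (1 / x - 1) = x / (1 - x)" using 3 1(4) by (simp add: field_simps)
    then have "F x = F (1 / x - 1) + F (x / (1 - x))"
      using F(3)[of "1 / x - 1"] 3 1(4) by simp
    then show ?thesis using 1 3 by (subst codenominator_rec.simps) auto
  qed
qed

lemma codenominator_ex1: "\<exists>!F. is_codenominator F \<and> (\<forall>x\<le>0. F x = 0)"
proof (rule ex1I)
  show "is_codenominator codenominator_rec \<and> (\<forall>x\<le>0. codenominator_rec x = 0)"
    using is_codenominator_rec by (auto simp: codenominator_rec.simps)
next
  fix F assume F: "is_codenominator F \<and> (\<forall>x\<le>0. F x = 0)"
  show "F = codenominator_rec"
  proof
    fix x show "F x = codenominator_rec x"
    proof (cases "0 < x")
      case True
      then show ?thesis using F is_codenominator_unique by blast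
    next
      case False
      then show ?thesis using F by (simp add: codenominator_rec.simps)
    qed
  qed
qed

lemma is_codenominator_codenominator: "is_codenominator codenominator"
  using theI'[OF codenominator_ex1] unfolding codenominator_def by blast

end

theory Submission
  imports Defs
begin

text \<open>Put a = F(x), b = F(1/x). The functional equations turn the shift x -> 1 + x into the
  Fibonacci step (a, b) -> (b, a + b), which negates the quadratic form b^2 - a b - a^2 defining
  \<open>cds\<close>.\<close>

lemma cds_one_plus:
  assumes "x > 0"
  shows "cds (1 + x) = - cds x"
proof -
  note F = is_codenominator_codenominator[unfolded is_codenominator_def]
  have "1 / x > 0" using assms by simp
  \<comment> \<open>The equation F(1 + 1/y) = F(y) is taken at y = 1/x, so that its left side
    becomes F(1 + x).\<close>
  then have "codenominator (1 + 1 / (1 / x)) = codenominator (1 / x)" using F by blast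
  then have "codenominator (1 + x) = codenominator (1 / x)" by simp
  moreover have "codenominator (1 / (1 + x)) = codenominator x + codenominator (1 / x)"
    using F assms by blast
  ultimately show ?thesis unfolding cds_def by (simp add: power2_eq_square algebra_simps)
qed

theorem lemma1:
  shows "(\<forall>x::rat. x > 0 \<longrightarrow> cds (1 + x) = - cds x) \<and>
         (\<forall>x::rat. x > 0 \<longrightarrow> cds (x + 2) = cds x)"
proof (intro conjI allI impI)
  fix x :: rat assume x: "x > 0"
  show "cds (1 + x) = - cds x" using x by (rule cds_one_plus)
  \<comment> \<open>The sign changes at x and at 1 + x cancel.\<close>
  show "cds (x + 2) = cds x"
    using x cds_one_plus[of x] cds_one_plus[of "1 + x"] by (simp add: add.commute)
qed

end
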